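(* Let $r\in\mathbb{N}$ and let $G$ be a graph with at least one edge such that $\Delta(G)-1\le r$. (i) If $r\le 7$ and $k\ge r+1$, then $G$ is equitably $k$-list arborable. (ii) If $k\ge r+1+\frac{r-1}{7}$ when $r\le 30$, or $k\ge r+\frac{r}{6}$ when $r\ge 31$, then $G$ is equitably $k$-list arborable. (iii) If $|V(G)|\ge r^3$ and $k\ge r+2$, then $G$ is equitably $k$-list arborable. (iv) If $\omega(G)\le r$ and $|V(G)|\ge 3(r+1)r^8$, then $G$ is equitably $(r+1)$-list arborable.
   Context: All graphs are finite, simple and undirected; $\Delta(G)$ is the maximum degree and $\omega(G)$ the clique number. A $k$-uniform list assignment $L$ for $G$ assigns to each vertex $v$ a set $L(v)$ of exactly $k$ colours (positive integers); an $L$-colouring is a map $c$ with $c(v)\in L(v)$ for all $v$. An $L$-colouring is equitable if every colour class has at most $\lceil |V(G)|/k\rceil$ vertices. $G$ is equitably $k$-list arborable if for every $k$-uniform list assignment $L$ there is an equitable $L$-colouring of $G$ in which every colour class induces an acyclic subgraph of $G$. *)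

theory Defs
  imports Complex_Main "HOL-Library.Ramsey"
begin

locale simple_graph =
  fixes V :: "'a set" and E :: "'a set set"
  assumes finite_vertices: "finite V"
    and edges_two_subsets: "\<And>e. e \<in> E \<Longrightarrow> e \<subseteq> V \<and> card e = 2"

definition degree :: "'a set set \<Rightarrow> 'a \<Rightarrow> nat" where
  "degree E v = card {e \<in> E. v \<in> e}"

(* Meaningful for finite nonempty V. *)
definition max_degree :: "'a set \<Rightarrow> 'a set set \<Rightarrow> nat" where
  "max_degree V E = Max (degree E ` V)"

definition clique_number :: "'a set \<Rightarrow> 'a set set \<Rightarrow> nat" where
  "clique_number V E = Max {card K | K. K \<subseteq> V \<and> clique K E}"

definition induced_edges :: "'a set \<Rightarrow> 'a set set \<Rightarrow> 'a set set" where
  "induced_edges S E = {e \<in> E. e \<subseteq> S}"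

(* The list enumerates the vertices of the cycle once, in cyclic order. *)
definition graph_cycle :: "'a set set \<Rightarrow> 'a list \<Rightarrow> bool" where
  "graph_cycle E p \<longleftrightarrow> length p \<ge> 3 \<and> distinct p \<and>
     (\<forall>i<length p. {p ! i, p ! (Suc i mod length p)} \<in> E)"

definition acyclic_graph :: "'a set set \<Rightarrow> bool" where
  "acyclic_graph E \<longleftrightarrow> \<not> (\<exists>p. graph_cycle E p)"

(* Colours are positive integers, represented as nonzero naturals. Finiteness is stated
   separately because card is 0 on infinite sets. *)
definition uniform_list_assignment :: "'a set \<Rightarrow> nat \<Rightarrow> ('a \<Rightarrow> nat set) \<Rightarrow> bool" where
  "uniform_list_assignment V k L \<longleftrightarrow>
     (\<forall>v\<in>V. L v \<subseteq> {i. i > 0} \<and> finite (L v) \<and> card (L v) = k)"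

definition list_colouring :: "'a set \<Rightarrow> ('a \<Rightarrow> nat set) \<Rightarrow> ('a \<Rightarrow> nat) \<Rightarrow> bool" where
  "list_colouring V L c \<longleftrightarrow> (\<forall>v\<in>V. c v \<in> L v)"

definition colour_class :: "'a set \<Rightarrow> ('a \<Rightarrow> nat) \<Rightarrow> nat \<Rightarrow> 'a set" where
  "colour_class V c i = {v \<in> V. c v = i}"

definition equitable_colouring :: "'a set \<Rightarrow> nat \<Rightarrow> ('a \<Rightarrow> nat) \<Rightarrow> bool" where
  "equitable_colouring V k c \<longleftrightarrow>
     (\<forall>i. int (card (colour_class V c i)) \<le> \<lceil>real (card V) / real k\<rceil>)"

definition equitably_list_arborable :: "'a set \<Rightarrow> 'a set set \<Rightarrow> nat \<Rightarrow> bool" where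
  "equitably_list_arborable V E k \<longleftrightarrow>
     (\<forall>L. uniform_list_assignment V k L \<longrightarrow>
       (\<exists>c. list_colouring V L c \<and> equitable_colouring V k c \<and>
         (\<forall>i. acyclic_graph (induced_edges (colour_class V c i) E))))"

end

theory Submission
  imports Defs
begin

text \<open>
  All four bounds on \<open>k\<close> imply \<open>k \<ge> r + 1 \<ge> \<Delta>(G)\<close>, and this alone suffices. Put \<open>s = \<lceil>n/k\<rceil>\<close>
  and colour the vertices one at a time, keeping all classes acyclic of size at most \<open>s\<close>.
  A vertex may enter a class containing at most one of its neighbours without creating a cycle.
  If the new vertex \<open>x\<close> can enter a class from which a chain of such moves leads to a class with
  fewer than \<open>s\<close> vertices, shift along the chain. Otherwise let \<open>A\<close> be the set of the colours from
  which no chain leads to such a class, and \<open>a = |A|\<close>. Every class of \<open>A\<close> has \<open>s\<close> vertices,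
  and \<open>2a \<ge> k\<close> since at most half of the colours of \<open>x\<close> are blocked by two neighbours of \<open>x\<close>.
  A vertex in a class of \<open>A\<close> has at least two neighbours in the class of each of the at least \<open>k - a\<close>
  colours of its list outside \<open>A\<close>, which gives at least \<open>2(k - a)sa\<close> edges to the fewer than
  \<open>s(k - a)\<close> coloured vertices outside \<open>A\<close>. So one of those has degree more than \<open>2a \<ge> k\<close>.
\<close>

section \<open>Neighbourhoods, cycles and forests\<close>

definition neighbours_in :: "'a set set \<Rightarrow> 'a set \<Rightarrow> 'a \<Rightarrow> 'a set" where
  "neighbours_in E X v = {u \<in> X. {v, u} \<in> E}"

lemma finite_neighbours_in [simp]: "finite X \<Longrightarrow> finite (neighbours_in E X v)"
  by (simp add: neighbours_in_def)

lemma neighbours_in_mono: "X \<subseteq> Y \<Longrightarrow> neighbours_in E X v \<subseteq> neighbours_in E Y v"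
  by (auto simp: neighbours_in_def)

lemma finite_colour_class [simp]: "finite S \<Longrightarrow> finite (colour_class S c i)"
  by (simp add: colour_class_def)

lemma graph_cycle_mono: "graph_cycle E p \<Longrightarrow> E \<subseteq> F \<Longrightarrow> graph_cycle F p"
  unfolding graph_cycle_def by blast

lemma acyclic_induced_mono:
  assumes "acyclic_graph (induced_edges Y E)" "X \<subseteq> Y"
  shows "acyclic_graph (induced_edges X E)"
proof -
  have "induced_edges X E \<subseteq> induced_edges Y E"
    using assms(2) by (auto simp: induced_edges_def)
  then show ?thesis
    using assms(1) graph_cycle_mono unfolding acyclic_graph_def by blast
qed

lemma graph_cycle_two_neighbours:
  assumes "graph_cycle E p" "v \<in> set p"
  obtains u w where "u \<noteq> w" "{v, u} \<in> E" "{v, w} \<in> E"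
proof -
  let ?n = "length p"
  have n: "?n \<ge> 3" and d: "distinct p"
    and e: "\<And>i. i < ?n \<Longrightarrow> {p ! i, p ! (Suc i mod ?n)} \<in> E"
    using assms(1) by (auto simp: graph_cycle_def)
  obtain i where i: "i < ?n" "p ! i = v"
    using assms(2) by (auto simp: in_set_conv_nth)
  \<comment> \<open>\<open>j\<close> is the cyclic predecessor of \<open>i\<close>; it differs from
    the cyclic successor because the length is at least 3.\<close>
  define j where "j = (if i = 0 then ?n - 1 else i - 1)"
  have j: "j < ?n" "Suc j mod ?n = i"
    using i(1) n by (auto simp: j_def)
  have "Suc i mod ?n \<noteq> j"
    using i(1) n by (cases "Suc i = ?n") (auto simp: j_def)
  moreover have "Suc i mod ?n < ?n"
    using n by (intro mod_less_divisor) linarith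
  ultimately have "p ! (Suc i mod ?n) \<noteq> p ! j"
    using j(1) d by (simp add: nth_eq_iff_index_eq)
  moreover have "{v, p ! (Suc i mod ?n)} \<in> E"
    using e[OF i(1)] i(2) by simp
  moreover have "{v, p ! j} \<in> E"
    using e[OF j(1)] j(2) i(2) by (simp add: insert_commute)
  ultimately show thesis
    using that by blast
qed

context simple_graph
begin

lemma finite_edges: "finite E"
proof (rule finite_subset)
  show "E \<subseteq> Pow V"
    using edges_two_subsets by blast
qed (simp add: finite_vertices)

lemma no_loop: "{v, v} \<notin> E"
  using edges_two_subsets[of "{v, v}"] by auto

lemma card_neighbours_in_le_degree: "card (neighbours_in E X v) \<le> degree E v"
  unfolding degree_def
proof (rule card_inj_on_le)
  show "inj_on (\<lambda>u. {v, u}) (neighbours_in E X v)"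
    by (auto simp: inj_on_def doubleton_eq_iff)
  show "(\<lambda>u. {v, u}) ` neighbours_in E X v \<subseteq> {e \<in> E. v \<in> e}"
    by (auto simp: neighbours_in_def)
  show "finite {e \<in> E. v \<in> e}"
    using finite_edges by simp
qed

text \<open>A new cycle would have to pass through \<open>v\<close>, which would then have two
  neighbours in \<open>X\<close>.\<close>

lemma acyclic_induced_insert:
  assumes "finite X" "acyclic_graph (induced_edges X E)" "card (neighbours_in E X v) \<le> 1"
  shows "acyclic_graph (induced_edges (insert v X) E)"
  unfolding acyclic_graph_def
proof
  let ?F = "induced_edges (insert v X) E"
  assume "\<exists>p. graph_cycle ?F p"
  then obtain p where p: "graph_cycle ?F p" by blast
  show False
  proof (cases "v \<in> set p")
    case True
    obtain u w where uw: "u \<noteq> w" "{v, u} \<in> ?F" "{v, w} \<in> ?F"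
      using graph_cycle_two_neighbours[OF p True] .
    then have "{u, w} \<subseteq> neighbours_in E X v"
      using no_loop by (auto simp: induced_edges_def neighbours_in_def)
    then have "card {u, w} \<le> card (neighbours_in E X v)"
      using assms(1) by (intro card_mono) auto
    then show False
      using uw(1) assms(3) by simp
  next
    case False
    have "{p ! i, p ! (Suc i mod length p)} \<in> induced_edges X E" if "i < length p" for i
    proof -
      have "Suc i mod length p < length p"
        using that by (intro mod_less_divisor) linarith
      then have "p ! i \<noteq> v" "p ! (Suc i mod length p) \<noteq> v"
        using False that nth_mem by metis+
      then show ?thesis
        using p that by (auto simp: graph_cycle_def induced_edges_def)
    qed
    then have "graph_cycle (induced_edges X E) p"
      using p by (simp add: graph_cycle_def)
    then show False
      using assms(2) by (auto simp: acyclic_graph_def)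
  qed
qed

text \<open>Colour classes are disjoint, so each colour in \<open>B\<close> accounts for two
  neighbours of its own.\<close>

lemma two_times_crowded_colours_le:
  assumes "finite S" "finite B"
    and "\<And>i. i \<in> B \<Longrightarrow> card (neighbours_in E (colour_class S c i) v) \<ge> 2"
  shows "2 * card B \<le> card (neighbours_in E {u \<in> S. c u \<in> B} v)"
proof -
  have "2 * card B = (\<Sum>i\<in>B. 2)" by simp
  also have "\<dots> \<le> (\<Sum>i\<in>B. card (neighbours_in E (colour_class S c i) v))"
    using assms(3) by (rule sum_mono)
  also have "\<dots> = card (\<Union>i\<in>B. neighbours_in E (colour_class S c i) v)"
    using assms(1,2)
    by (intro card_UN_disjoint[symmetric]) (auto simp: neighbours_in_def colour_class_def)
  also have "(\<Union>i\<in>B. neighbours_in E (colour_class S c i) v) = neighbours_in E {u \<in> S. c u \<in> B} v"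
    by (auto simp: neighbours_in_def colour_class_def)
  finally show ?thesis .
qed

section \<open>Partial colourings and chains of moves\<close>

definition bounded_forest_colouring ::
    "('a \<Rightarrow> nat set) \<Rightarrow> nat \<Rightarrow> 'a set \<Rightarrow> ('a \<Rightarrow> nat) \<Rightarrow> bool" where
  "bounded_forest_colouring L s S c \<longleftrightarrow> list_colouring S L c \<and>
     (\<forall>i. card (colour_class S c i) \<le> s \<and> acyclic_graph (induced_edges (colour_class S c i) E))"

text \<open>The size of the class is left out on purpose: chains pass through full classes.\<close>

definition can_enter :: "('a \<Rightarrow> nat set) \<Rightarrow> 'a set \<Rightarrow> ('a \<Rightarrow> nat) \<Rightarrow> 'a \<Rightarrow> nat \<Rightarrow> bool" where
  "can_enter L S c v i \<longleftrightarrow> i \<in> L v \<and> card (neighbours_in E (colour_class S c i) v) \<le> 1"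

text \<open>The arcs of an auxiliary digraph on the colours, of the kind used in proofs of the
  Hajnal-Szemeredi theorem.\<close>

definition shiftable :: "('a \<Rightarrow> nat set) \<Rightarrow> 'a set \<Rightarrow> ('a \<Rightarrow> nat) \<Rightarrow> nat \<Rightarrow> nat \<Rightarrow> bool" where
  "shiftable L S c i j \<longleftrightarrow> (\<exists>w\<in>S. c w = i \<and> can_enter L S c w j)"

lemma bounded_forest_colouring_insert:
  assumes c: "bounded_forest_colouring L s S c" and fin: "finite S" and x: "x \<notin> S"
    and "can_enter L S c x i" "card (colour_class S c i) < s"
  shows "bounded_forest_colouring L s (insert x S) (c(x := i))"
proof -
  have cls: "colour_class (insert x S) (c(x := i)) j =
      (if j = i then insert x (colour_class S c i) else colour_class S c j)" for j
    using x by (auto simp: colour_class_def)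
  have "x \<notin> colour_class S c i"
    using x by (simp add: colour_class_def)
  then show ?thesis
    using assms acyclic_induced_insert[of "colour_class S c i" x]
    by (auto simp: bounded_forest_colouring_def list_colouring_def cls can_enter_def)
qed

text \<open>The departure of \<open>w\<close> makes room for \<open>x\<close> even in a full class;
  \<open>w\<close> becomes the vertex still to be placed.\<close>

lemma bounded_forest_colouring_replace:
  assumes c: "bounded_forest_colouring L s S c" and fin: "finite S" and x: "x \<notin> S"
    and enter: "can_enter L S c x i" and w: "w \<in> S" "c w = i"
  shows "bounded_forest_colouring L s (insert x (S - {w})) (c(x := i))"
proof (rule bounded_forest_colouring_insert)
  have sub: "colour_class (S - {w}) c j \<subseteq> colour_class S c j" for j
    by (auto simp: colour_class_def)
  then have le: "card (colour_class (S - {w}) c j) \<le> card (colour_class S c j)" for j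
    using fin by (simp add: card_mono)
  show "bounded_forest_colouring L s (S - {w}) c"
    using c le sub acyclic_induced_mono
    unfolding bounded_forest_colouring_def list_colouring_def
    by (metis DiffD1 le_trans)
  show "can_enter L (S - {w}) c x i"
    using enter card_mono[OF _ neighbours_in_mono[OF sub]] fin
    unfolding can_enter_def by (meson finite_colour_class finite_neighbours_in le_trans)
  have "colour_class (S - {w}) c i \<subset> colour_class S c i"
    using w by (auto simp: colour_class_def)
  then have "card (colour_class (S - {w}) c i) < card (colour_class S c i)"
    using fin by (simp add: psubset_card_mono)
  then show "card (colour_class (S - {w}) c i) < s"
    using c unfolding bounded_forest_colouring_def by (meson less_le_trans)
qed (use fin x in auto)

text \<open>Distinctness of the colours of the chain ensures that the first move, which changes only
  the class of the first colour, keeps the rest of the chain intact.\<close>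

lemma bounded_forest_colouring_shift:
  assumes "bounded_forest_colouring L s S c" "finite S" "x \<notin> S" "can_enter L S c x i"
    and "distinct (i # p)" "successively (shiftable L S c) (i # p)"
    and "card (colour_class S c (last (i # p))) < s"
  shows "\<exists>c'. bounded_forest_colouring L s (insert x S) c'"
  using assms
proof (induction p arbitrary: S c x i)
  case Nil
  then show ?case
    using bounded_forest_colouring_insert by fastforce
next
  case (Cons j p)
  from Cons.prems(6) obtain w where w: "w \<in> S" "c w = i" "can_enter L S c w j"
    and rest: "successively (shiftable L S c) (j # p)"
    by (auto simp: shiftable_def)
  \<comment> \<open>\<open>?c\<close> still sends \<open>w\<close> to \<open>i\<close>, but
    \<open>w\<close> lies outside \<open>?S\<close> and so counts as uncoloured.\<close>
  let ?S = "insert x (S - {w})" and ?c = "c(x := i)"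
  have cls: "colour_class ?S ?c m = colour_class S c m" if "m \<noteq> i" for m
    using that w(2) Cons.prems(3) by (auto simp: colour_class_def)
  have "w \<noteq> x"
    using w(1) Cons.prems(3) by blast
  have enter: "can_enter L ?S ?c u m" if "can_enter L S c u m" "m \<noteq> i" for u m
    using that cls by (simp add: can_enter_def)
  have "successively (shiftable L ?S ?c) (j # p)"
  proof (rule successively_mono[OF rest])
    fix l m assume lm: "l \<in> set (j # p)" "m \<in> set (j # p)" "shiftable L S c l m"
    then have ne: "l \<noteq> i" "m \<noteq> i"
      using Cons.prems(5) by auto
    from lm(3) obtain u where u: "u \<in> S" "c u = l" "can_enter L S c u m"
      by (auto simp: shiftable_def)
    then have "u \<noteq> x" "u \<noteq> w"
      using Cons.prems(3) ne w(2) by auto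
    then show "shiftable L ?S ?c l m"
      using u enter[OF u(3) ne(2)] unfolding shiftable_def by auto
  qed
  moreover have "bounded_forest_colouring L s ?S ?c"
    using bounded_forest_colouring_replace[OF Cons.prems(1-4) w(1,2)] .
  moreover have "can_enter L ?S ?c w j"
    using enter[OF w(3)] Cons.prems(5) by auto
  moreover have "last (j # p) \<noteq> i"
    using Cons.prems(5) last_in_set[of "j # p"] by (metis distinct.simps(2) list.distinct(1))
  then have "card (colour_class ?S ?c (last (j # p))) < s"
    using Cons.prems(7) cls by auto
  moreover have "finite ?S" "w \<notin> ?S" "distinct (j # p)"
    using Cons.prems(2,5) \<open>w \<noteq> x\<close> by auto
  \<comment> \<open>The uncoloured vertex is now \<open>w\<close>, and it can enter the first class
    of the shorter chain.\<close>
  ultimately have "\<exists>c'. bounded_forest_colouring L s (insert w ?S) c'"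
    by (intro Cons.IH[of ?S ?c w j])
  moreover have "insert w ?S = insert x S"
    using w(1) by blast
  ultimately show ?case by (simp only:)
qed

section \<open>Extending a colouring by one vertex: the counting argument\<close>

lemma bounded_forest_colouring_step:
  assumes deg: "\<And>v. v \<in> V \<Longrightarrow> degree E v \<le> k" and k: "k > 0"
    and L: "uniform_list_assignment V k L"
    and c: "bounded_forest_colouring L s S c"
    and S: "insert x S \<subseteq> V" "x \<notin> S" "card (insert x S) \<le> s * k"
  shows "\<exists>c'. bounded_forest_colouring L s (insert x S) c'"
proof (rule ccontr)
  assume none: "\<not> ?thesis"
  have fin: "finite S"
    using S(1) finite_subset[OF _ finite_vertices, of S] by simp
  have less: "card S < s * k"
    using S fin by simp
  then have s: "s > 0"
    by (cases s) auto
  have finL: "finite (L v)" and cardL: "card (L v) = k" if "v \<in> V" for v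
    using L that by (auto simp: uniform_list_assignment_def)
  \<comment> \<open>A chain may consist of one colour, so \<open>T\<close> contains every colour
    whose class is not full, also those in no list.\<close>
  define T where "T = {i. \<exists>p. distinct (i # p) \<and> successively (shiftable L S c) (i # p) \<and>
    card (colour_class S c (last (i # p))) < s}"
  define A where "A = - T"
  have T_I: "i \<in> T" if "distinct (i # p)" "successively (shiftable L S c) (i # p)"
    "card (colour_class S c (last (i # p))) < s" for i p
    using that unfolding T_def by blast
  have T_pred: "i \<in> T" if ij: "shiftable L S c i j" and "j \<in> T" for i j
  proof -
    obtain p where p: "distinct (j # p)" "successively (shiftable L S c) (j # p)"
        "card (colour_class S c (last (j # p))) < s"
      using \<open>j \<in> T\<close> by (auto simp: T_def)
    show "i \<in> T"
    proof (cases "i \<in> set (j # p)")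
      case True
      \<comment> \<open>Prepending \<open>i\<close> would repeat a colour, but the part of the chain
        from \<open>i\<close> on is itself a chain with the same end.\<close>
      then obtain ys zs where yz: "j # p = ys @ i # zs"
        by (meson split_list)
      show ?thesis
      proof (rule T_I)
        show "distinct (i # zs)"
          using p(1) unfolding yz by simp
        show "successively (shiftable L S c) (i # zs)"
          using p(2) unfolding yz successively_append_iff by blast
        show "card (colour_class S c (last (i # zs))) < s"
          using p(3) unfolding yz by simp
      qed
    next
      case False
      then have "distinct (i # j # p)" "successively (shiftable L S c) (i # j # p)"
        using p ij by auto
      then show ?thesis
        using p(3) T_I[of i "j # p"] by simp
    qed
  qed
  have full: "card (colour_class S c i) = s" if "i \<in> A" for i
  proof -
    have "\<not> card (colour_class S c i) < s"
      using that T_I[of i "[]"] unfolding A_def by auto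
    then show ?thesis
      using c unfolding bounded_forest_colouring_def by (meson le_neq_implies_less)
  qed
  have x_crowded: "card (neighbours_in E (colour_class S c i) x) \<ge> 2" if "i \<in> L x - A" for i
  proof (rule ccontr)
    assume "\<not> ?thesis"
    then have "can_enter L S c x i"
      using that by (simp add: can_enter_def)
    then show False
      using that none bounded_forest_colouring_shift[OF c fin S(2)]
      unfolding A_def T_def by blast
  qed
  have A_crowded: "card (neighbours_in E (colour_class S c i) w) \<ge> 2"
    if "w \<in> S" "c w \<in> A" "i \<in> L w - A" for w i
  proof (rule ccontr)
    assume "\<not> ?thesis"
    then have "shiftable L S c (c w) i"
      using that by (auto simp: can_enter_def shiftable_def)
    then show False
      using that T_pred unfolding A_def by blast
  qed
  \<comment> \<open>\<open>A\<close> is a complement in all naturals; it is finite because its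
    classes are full and, as \<open>s > 0\<close>, nonempty.\<close>
  have finA: "finite A"
  proof (rule finite_subset)
    show "A \<subseteq> c ` S"
    proof
      fix i assume "i \<in> A"
      then have "colour_class S c i \<noteq> {}"
        using full s by fastforce
      then show "i \<in> c ` S"
        by (auto simp: colour_class_def)
    qed
  qed (simp add: fin)
  define a where "a = card A"
  have outside: "k - a \<le> card (L v - A)" if "v \<in> V" for v
    using diff_card_le_card_Diff[OF finA, of "L v"] cardL[OF that] by (simp add: a_def)
  define U where "U = {v \<in> S. c v \<in> A}"
  define W where "W = {v \<in> S. c v \<notin> A}"
  have finUW: "finite U" "finite W"
    using fin by (auto simp: U_def W_def)
  have "U = (\<Union>i\<in>A. colour_class S c i)"
    by (auto simp: U_def colour_class_def)
  then have "card U = (\<Sum>i\<in>A. card (colour_class S c i))"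
    using fin finA by (simp add: card_UN_disjoint colour_class_def disjoint_iff)
  then have cardU: "card U = s * a"
    using full by (simp add: a_def)
  have "S = U \<union> W" "U \<inter> W = {}"
    by (auto simp: U_def W_def)
  then have cardS: "card S = card U + card W"
    using card_Un_disjoint[OF finUW] by simp
  have "s * a < s * k"
    using less cardU cardS by linarith
  then have ak: "a < k" by simp
  \<comment> \<open>Strict because \<open>x\<close> is not yet coloured; the final contradiction
    rests on this.\<close>
  have cardW: "card W < s * (k - a)"
    using less cardU cardS ak by (simp add: diff_mult_distrib2)
  have "k \<le> 2 * a"
  proof -
    have xV: "x \<in> V" using S by blast
    have "2 * card (L x - A) \<le> k"
      using two_times_crowded_colours_le[OF fin _ x_crowded] finL[OF xV]
        card_neighbours_in_le_degree deg[OF xV] by (meson finite_Diff le_trans)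
    then show ?thesis
      using outside[OF xV] by linarith
  qed
  have "2 * (k - a) \<le> card (neighbours_in E W w)" if "w \<in> U" for w
  proof -
    have w: "w \<in> S" "c w \<in> A" "w \<in> V"
      using that S by (auto simp: U_def)
    have "2 * (k - a) \<le> 2 * card (L w - A)"
      using outside[OF w(3)] by simp
    also have "\<dots> \<le> card (neighbours_in E {u \<in> S. c u \<in> L w - A} w)"
      by (rule two_times_crowded_colours_le[OF fin]) (use finL[OF w(3)] A_crowded[OF w(1,2)] in auto)
    also have "\<dots> \<le> card (neighbours_in E W w)"
      using finUW by (intro card_mono neighbours_in_mono) (auto simp: W_def)
    finally show ?thesis .
  qed
  then have "(\<Sum>w\<in>U. 2 * (k - a)) \<le> (\<Sum>w\<in>U. card (neighbours_in E W w))"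
    by (rule sum_mono)
  \<comment> \<open>The edges between \<open>U\<close> and \<open>W\<close> are counted from both
    sides.\<close>
  also have "\<dots> = (\<Sum>w\<in>W. card (neighbours_in E U w))"
    unfolding neighbours_in_def
    by (rule sum_multicount_gen) (use finUW in \<open>auto simp: insert_commute\<close>)
  also have "\<dots> \<le> (\<Sum>w\<in>W. k)"
  proof (rule sum_mono)
    fix w assume "w \<in> W"
    then have "w \<in> V" using S by (auto simp: W_def)
    then show "card (neighbours_in E U w) \<le> k"
      using card_neighbours_in_le_degree deg le_trans by blast
  qed
  also have "\<dots> < s * (k - a) * k"
    using cardW k by simp
  also have "\<dots> \<le> s * (k - a) * (2 * a)"
    using \<open>k \<le> 2 * a\<close> by simp
  \<comment> \<open>Both ends of the chain equal \<open>2 * s * a * (k - a)\<close>, yet one of its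
    steps is strict.\<close>
  finally show False
    by (simp add: cardU algebra_simps)
qed

text \<open>The final class bound \<open>s\<close> is used from the first vertex on, so the
  intermediate colourings need not be equitable for their own vertex sets.\<close>

theorem equitably_list_arborable_of_degree_le:
  assumes deg: "\<And>v. v \<in> V \<Longrightarrow> degree E v \<le> k" and k: "k > 0"
  shows "equitably_list_arborable V E k"
  unfolding equitably_list_arborable_def
proof (intro allI impI)
  fix L assume L: "uniform_list_assignment V k L"
  define s where "s = nat \<lceil>real (card V) / real k\<rceil>"
  \<comment> \<open>This makes the ceiling nonnegative, so \<open>nat\<close> does not change its
    value.\<close>
  have "-1 < real (card V) / real k"
    by (rule less_le_trans[of _ 0]) auto
  then have s: "int s = \<lceil>real (card V) / real k\<rceil>"
    by (simp add: s_def)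
  have "real (card V) / real k \<le> real s"
    using s by linarith
  then have "real (card V) \<le> real s * real k"
    using k by (simp add: divide_le_eq)
  then have V: "card V \<le> s * k"
    by (metis of_nat_le_iff of_nat_mult)
  have "\<exists>c. bounded_forest_colouring L s S c" if "S \<subseteq> V" for S
    using finite_subset[OF that finite_vertices] that
  proof (induction S rule: finite_induct)
    case empty
    have "induced_edges {} E = {}"
      using edges_two_subsets by (fastforce simp: induced_edges_def)
    \<comment> \<open>Index 0 already violates the cycle condition when there are no edges.\<close>
    then have "bounded_forest_colouring L s {} c" for c
      by (auto simp: bounded_forest_colouring_def list_colouring_def colour_class_def
          acyclic_graph_def graph_cycle_def intro!: exI[of _ 0])
    then show ?case by blast
  next
    case (insert x S)
    have "card (insert x S) \<le> s * k"
      using card_mono[OF finite_vertices insert.prems] V by linarith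
    then show ?case
      using insert bounded_forest_colouring_step[OF deg k L] by blast
  qed
  then obtain c where "bounded_forest_colouring L s V c" by blast
  then show "\<exists>c. list_colouring V L c \<and> equitable_colouring V k c \<and>
      (\<forall>i. acyclic_graph (induced_edges (colour_class V c i) E))"
    unfolding bounded_forest_colouring_def equitable_colouring_def s[symmetric] by auto
qed

end

theorem theorem2:
  fixes V :: "'a set" and E :: "'a set set" and r :: nat
  assumes "simple_graph V E"
    and "E \<noteq> {}"
    and "int (max_degree V E) - 1 \<le> int r"
  shows "(r \<le> 7 \<longrightarrow> (\<forall>k::nat. k \<ge> r + 1 \<longrightarrow> equitably_list_arborable V E k)) \<and>
    (\<forall>k::nat. (r \<le> 30 \<and> real k \<ge> real r + 1 + (real r - 1) / 7 \<or>
               r \<ge> 31 \<and> real k \<ge> real r + real r / 6)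
       \<longrightarrow> equitably_list_arborable V E k) \<and>
    (card V \<ge> r ^ 3 \<longrightarrow> (\<forall>k::nat. k \<ge> r + 2 \<longrightarrow> equitably_list_arborable V E k)) \<and>
    (clique_number V E \<le> r \<and> card V \<ge> 3 * (r + 1) * r ^ 8
       \<longrightarrow> equitably_list_arborable V E (r + 1))"
proof -
  interpret simple_graph V E by fact
  have deg: "degree E v \<le> r + 1" if "v \<in> V" for v
  proof -
    have "degree E v \<le> max_degree V E"
      using that finite_vertices by (simp add: max_degree_def)
    then show ?thesis
      using assms(3) by linarith
  qed
  have main: "equitably_list_arborable V E k" if "k \<ge> r + 1" for k
    using that deg by (intro equitably_list_arborable_of_degree_le) (auto intro: le_trans)
  have "k \<ge> r + 1" if "r \<le> 30 \<and> real k \<ge> real r + 1 + (real r - 1) / 7 \<or>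
      r \<ge> 31 \<and> real k \<ge> real r + real r / 6" for k
  proof -
    \<comment> \<open>For \<open>r = 0\<close> the bound is only \<open>k >= 6/7\<close>; the
      integrality of \<open>k\<close> yields \<open>r + 1\<close>.\<close>
    have "real k > real r"
      using that by (auto simp: field_simps)
    then show ?thesis by linarith
  qed
  then show ?thesis
    using main by auto
qed

end
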